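(* Let $p$ be a fixed prime. Then the sequence of commuting graphs $\langle \Gamma(H_{2k+1}(p)) : k \rightarrow \infty \rangle$ is quasirandom.
   Context: Heisenberg group: for a prime $p$ and $k \geq 1$, $H_{2k+1}(p) = \{[x,y,z] : x,y \in \mathbb{F}_p^k,\ z \in \mathbb{F}_p\}$ with product $[x,y,z][x',y',z'] = [x+x', y+y', z+z'+x\cdot y']$, where $x\cdot y' = x_1y'_1+\cdots+x_ky'_k$. The commuting graph $\Gamma(H_{2k+1}(p))$ has as vertices all elements of $H_{2k+1}(p)$, two elements being adjacent if and only if they commute (so there is a loop at every vertex). Quasirandomness: for a graph $G$ (loops allowed) on $N$ vertices, $N(v)$ denotes the neighborhood of $v$, and the density $\delta$ is the number of ordered pairs $(v,w)$ of adjacent vertices divided by $N^2$. A sequence of graphs $G$ with number of vertices $N\to\infty$ is quasirandom if $\sum_{v,w\in V(G)} \big|\,|N(v)\cap N(w)| - \delta^2 N\,\big| = o(N^3)$ (the sum being over ordered pairs of vertices). *)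

theory Defs
  imports
    "HOL-Number_Theory.Residues"
    "HOL-Library.FuncSet"
    "HOL-Library.Landau_Symbols"
    "Graph_Theory.Pair_Digraph"
begin

section \<open>Heisenberg groups\<close>

type_synonym heis = "(nat \<Rightarrow> int) \<times> (nat \<Rightarrow> int) \<times> int"

abbreviation prime_ring :: "nat \<Rightarrow> int ring" where
  "prime_ring p \<equiv> residue_ring (int p)"

text \<open>Vectors of length \<open>k\<close> are extensional functions on \<open>{1..k}\<close>, so that each vector has
  a unique representation.\<close>

definition vecs :: "nat \<Rightarrow> nat \<Rightarrow> (nat \<Rightarrow> int) set" where
  "vecs p k = {1..k} \<rightarrow>\<^sub>E carrier (prime_ring p)"

definition vec_add :: "nat \<Rightarrow> nat \<Rightarrow> (nat \<Rightarrow> int) \<Rightarrow> (nat \<Rightarrow> int) \<Rightarrow> nat \<Rightarrow> int" where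
  "vec_add p k x y = (\<lambda>i\<in>{1..k}. x i \<oplus>\<^bsub>prime_ring p\<^esub> y i)"

definition dot :: "nat \<Rightarrow> nat \<Rightarrow> (nat \<Rightarrow> int) \<Rightarrow> (nat \<Rightarrow> int) \<Rightarrow> int" where
  "dot p k x y = (\<Oplus>\<^bsub>prime_ring p\<^esub>i\<in>{1..k}. x i \<otimes>\<^bsub>prime_ring p\<^esub> y i)"

definition heisenberg :: "nat \<Rightarrow> nat \<Rightarrow> heis monoid" where
  "heisenberg p k =
    \<lparr>carrier = vecs p k \<times> vecs p k \<times> carrier (prime_ring p),
     monoid.mult = (\<lambda>(x, y, z) (x', y', z').
       (vec_add p k x x', vec_add p k y y',
        z \<oplus>\<^bsub>prime_ring p\<^esub> z' \<oplus>\<^bsub>prime_ring p\<^esub> dot p k x y')),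
     one = (\<lambda>i\<in>{1..k}. \<zero>\<^bsub>prime_ring p\<^esub>, \<lambda>i\<in>{1..k}. \<zero>\<^bsub>prime_ring p\<^esub>, \<zero>\<^bsub>prime_ring p\<^esub>)\<rparr>"

lemma card_heisenberg: "card (carrier (heisenberg p k)) = p ^ (2 * k + 1)"
proof -
  have "card (vecs p k) = p ^ k"
    by (simp add: vecs_def residue_ring_def card_PiE)
  then show ?thesis
    by (simp add: heisenberg_def residue_ring_def card_cartesian_product power_add mult_2)
qed

lemma group_heisenberg:
  assumes "prime p"
  shows "group (heisenberg p k)"
proof -
  interpret F: residues_prime p "prime_ring p"
    by unfold_locales (use assms in auto)
  note clos = F.add.m_closed F.m_closed F.zero_closed
  have comp: "x i \<in> carrier (prime_ring p)"
    if "x \<in> vecs p k" "i \<in> {1..k}" for x i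
    using that by (auto simp: vecs_def)
  have dot_closed: "dot p k x y \<in> carrier (prime_ring p)"
    if "x \<in> vecs p k" "y \<in> vecs p k" for x y
    using that unfolding dot_def vecs_def by (intro F.finsum_closed) auto
  have add_closed: "vec_add p k x y \<in> vecs p k"
    if "x \<in> vecs p k" "y \<in> vecs p k" for x y
    using that unfolding vec_add_def vecs_def by auto
  have add_assoc: "vec_add p k (vec_add p k x y) z = vec_add p k x (vec_add p k y z)"
    if "x \<in> vecs p k" "y \<in> vecs p k" "z \<in> vecs p k" for x y z
    using that unfolding vec_add_def vecs_def
    by (auto simp: fun_eq_iff restrict_def PiE_def Pi_def F.a_assoc)
  have dot_left: "dot p k (vec_add p k x y) z = dot p k x z \<oplus>\<^bsub>prime_ring p\<^esub> dot p k y z"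
    if "x \<in> vecs p k" "y \<in> vecs p k" "z \<in> vecs p k" for x y z
  proof -
    have m: "x i \<in> carrier (prime_ring p)" "y i \<in> carrier (prime_ring p)"
      "z i \<in> carrier (prime_ring p)" if "i \<in> {1..k}" for i
      using that \<open>x \<in> _\<close> \<open>y \<in> _\<close> \<open>z \<in> _\<close> by (auto simp: vecs_def)
    have "dot p k (vec_add p k x y) z = (\<Oplus>\<^bsub>prime_ring p\<^esub>i\<in>{1..k}.
        x i \<otimes>\<^bsub>prime_ring p\<^esub> z i \<oplus>\<^bsub>prime_ring p\<^esub> y i \<otimes>\<^bsub>prime_ring p\<^esub> z i)"
      unfolding dot_def vec_add_def by (rule F.finsum_cong') (use m in \<open>auto simp: F.l_distr\<close>)
    also have "\<dots> = dot p k x z \<oplus>\<^bsub>prime_ring p\<^esub> dot p k y z"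
      unfolding dot_def by (rule F.finsum_addf) (use m in auto)
    finally show ?thesis .
  qed
  have dot_right: "dot p k x (vec_add p k y z) = dot p k x y \<oplus>\<^bsub>prime_ring p\<^esub> dot p k x z"
    if "x \<in> vecs p k" "y \<in> vecs p k" "z \<in> vecs p k" for x y z
  proof -
    have comm: "dot p k u v = dot p k v u" if "u \<in> vecs p k" "v \<in> vecs p k" for u v
      unfolding dot_def
      by (rule F.finsum_cong') (use that comp in \<open>auto simp: F.m_comm\<close>)
    show ?thesis
      using that by (simp add: comm[of x] add_closed dot_left)
  qed
  define o0 where "o0 = (\<lambda>i\<in>{1..k}. \<zero>\<^bsub>prime_ring p\<^esub>)"
  have o0: "o0 \<in> vecs p k" by (auto simp: o0_def vecs_def)
  have add_o0: "vec_add p k o0 x = x" if "x \<in> vecs p k" for x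
    using that unfolding vec_add_def vecs_def o0_def
    by (auto simp: fun_eq_iff restrict_def PiE_def Pi_def extensional_def)
  have dot_o0: "dot p k o0 x = \<zero>\<^bsub>prime_ring p\<^esub>" if "x \<in> vecs p k" for x
  proof -
    have "dot p k o0 x = (\<Oplus>\<^bsub>prime_ring p\<^esub>i\<in>{1..k}. \<zero>\<^bsub>prime_ring p\<^esub>)"
      unfolding dot_def o0_def
      by (rule F.finsum_cong') (use that comp in auto)
    then show ?thesis by (simp add: F.add.finprod_one_eqI)
  qed
  have neg: "\<exists>x'\<in>vecs p k. vec_add p k x' x = o0" if "x \<in> vecs p k" for x
  proof
    show "(\<lambda>i\<in>{1..k}. \<ominus>\<^bsub>prime_ring p\<^esub> x i) \<in> vecs p k"
      using that by (auto simp: vecs_def)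
    show "vec_add p k (\<lambda>i\<in>{1..k}. \<ominus>\<^bsub>prime_ring p\<^esub> x i) x = o0"
      using that unfolding vec_add_def vecs_def o0_def
      by (auto simp: fun_eq_iff restrict_def PiE_def Pi_def F.l_neg)
  qed
  show ?thesis
  proof (rule groupI)
    fix a b c
    assume "a \<in> carrier (heisenberg p k)" "b \<in> carrier (heisenberg p k)"
      "c \<in> carrier (heisenberg p k)"
    then show "a \<otimes>\<^bsub>heisenberg p k\<^esub> b \<otimes>\<^bsub>heisenberg p k\<^esub> c =
        a \<otimes>\<^bsub>heisenberg p k\<^esub> (b \<otimes>\<^bsub>heisenberg p k\<^esub> c)"
      by (auto simp: heisenberg_def add_assoc dot_left dot_right dot_closed clos F.a_ac)
  next
    fix a assume a: "a \<in> carrier (heisenberg p k)"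
    obtain x y z where a_eq: "a = (x, y, z)" by (cases a) auto
    with a have m: "x \<in> vecs p k" "y \<in> vecs p k" "z \<in> carrier (prime_ring p)"
      by (auto simp: heisenberg_def)
    obtain x' y' where xy: "x' \<in> vecs p k" "vec_add p k x' x = o0"
      "y' \<in> vecs p k" "vec_add p k y' y = o0" using neg m by meson
    define z' where "z' = \<ominus>\<^bsub>prime_ring p\<^esub> (z \<oplus>\<^bsub>prime_ring p\<^esub> dot p k x' y)"
    have dc: "dot p k x' y \<in> carrier (prime_ring p)" using xy m dot_closed by simp
    have z': "z' \<in> carrier (prime_ring p)" using m dc by (simp add: z'_def)
    have "z' \<oplus>\<^bsub>prime_ring p\<^esub> z \<oplus>\<^bsub>prime_ring p\<^esub> dot p k x' y = \<zero>\<^bsub>prime_ring p\<^esub>"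
      using m dc by (simp add: z'_def F.a_assoc F.l_neg)
    then show "\<exists>b\<in>carrier (heisenberg p k). b \<otimes>\<^bsub>heisenberg p k\<^esub> a = \<one>\<^bsub>heisenberg p k\<^esub>"
      using xy z' by (intro bexI[of _ "(x', y', z')"])
        (auto simp: heisenberg_def a_eq o0_def)
  qed (auto simp: heisenberg_def add_closed dot_closed clos
        o0[unfolded o0_def, simplified] add_o0[unfolded o0_def, simplified]
        dot_o0[unfolded o0_def, simplified])
qed


section \<open>Commuting graphs\<close>

text \<open>A graph, possibly with loops, is a symmetric set of ordered pairs of vertices.\<close>

definition commuting_graph :: "('a, 'b) monoid_scheme \<Rightarrow> 'a pair_pre_digraph" where
  "commuting_graph G =
    \<lparr>pverts = carrier G,
     parcs = {(g, h). g \<in> carrier G \<and> h \<in> carrier G \<and> g \<otimes>\<^bsub>G\<^esub> h = h \<otimes>\<^bsub>G\<^esub> g}\<rparr>"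


section \<open>Quasirandom sequences of graphs\<close>

definition neighborhood :: "'a pair_pre_digraph \<Rightarrow> 'a \<Rightarrow> 'a set" where
  "neighborhood G v = {w \<in> pverts G. (v, w) \<in> parcs G}"

text \<open>\<^const>\<open>parcs\<close> consists of ordered pairs: a loop counts once, any other edge twice.\<close>

definition density :: "'a pair_pre_digraph \<Rightarrow> real" where
  "density G = real (card (parcs G)) / (real (card (pverts G)))\<^sup>2"

definition quasirandom :: "(nat \<Rightarrow> 'a pair_pre_digraph) \<Rightarrow> bool" where
  "quasirandom G \<longleftrightarrow>
     (\<forall>n. pair_pseudo_graph (G n)) \<and>
     filterlim (\<lambda>n. card (pverts (G n))) at_top sequentially \<and>
     (\<lambda>n. \<Sum>v\<in>pverts (G n). \<Sum>w\<in>pverts (G n).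
        \<bar>real (card (neighborhood (G n) v \<inter> neighborhood (G n) w))
          - (density (G n))\<^sup>2 * real (card (pverts (G n)))\<bar>)
       \<in> o(\<lambda>n. real (card (pverts (G n))) ^ 3)"

end

theory Submission
  imports Defs
begin

text \<open>
  Two elements \<open>g = [x, y, z]\<close> and \<open>h = [x', y', z']\<close> of the Heisenberg group commute iff
  the symplectic form \<open>\<beta> g h = x \<cdot> y' - x' \<cdot> y\<close> vanishes modulo \<open>p\<close>. So neighborhoods in the
  commuting graph are centralizers, that is, kernels of the linear functionals \<open>\<beta> g\<close>, and
  common neighborhoods are intersections of two such kernels. Write \<open>N\<close> for the order of the
  group. The kernel of a nonzero functional has \<open>N / p\<close> elements, and the intersection of two
  kernels has \<open>N / p\<^sup>2\<close> elements as soon as the functionals are linearly independent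
  (\<open>card_C\<close>, \<open>card_C_Int_C\<close>). Hence nearly every pair of vertices has the number of common
  neighbors expected in a random graph of density \<open>1 / p\<close>.

  The errors are controlled by the center \<open>Z\<close>. At most \<open>(p + 1) |Z| N\<close> pairs are dependent
  (\<open>card_dependent\<close>), each contributing at most \<open>N\<close>; and since only central elements
  have a centralizer larger than \<open>N / p\<close>, the square of the density differs from \<open>1 / p\<^sup>2\<close>
  by at most \<open>2 |Z| / N\<close> (\<open>density_square_close\<close>). The total deviation is therefore at most
  \<open>(p + 3) |Z| N\<^sup>2\<close> (\<open>codegree_deviation\<close>). In the Heisenberg group \<open>|Z|\<close> is at
  most \<open>p\<close>, whatever the dimension (\<open>card_center_heisenberg\<close>), so with \<open>p\<close> fixed the
  deviation is \<open>O(N\<^sup>2)\<close>, which is \<open>o(N\<^sup>3)\<close>.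

  The counting is carried out in any finite group whose commutation is detected by a
  skew form with values modulo \<open>p\<close>. Linear algebra is replaced by one device: average over a
  line \<open>t \<mapsto> h g\<^sup>t\<close> with \<open>t < p\<close>, and use that a nonconstant linear congruence in \<open>t\<close> has
  exactly one solution.
\<close>

section \<open>Counting solutions of a linear congruence\<close>

lemma card_linear_congruence:
  fixes p :: nat and a b :: int
  assumes p: "prime p" and a: "\<not> int p dvd a"
  shows "card {t. t < p \<and> int p dvd b + int t * a} = 1"
proof -
  have "coprime a (int p)"
    using p a by (metis coprime_commute prime_imp_coprime prime_nat_int_transfer)
  then obtain c where c: "[a * c = 1] (mod int p)"
    using cong_solve_coprime_int by blast
  define s where "s = nat ((- b * c) mod int p)"
  have ppos: "0 < p" using p prime_gt_0_nat by blast
  have s: "int s = (- b * c) mod int p" using ppos by (simp add: s_def)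
  have "[b + int s * a = b + (- b * c) * a] (mod int p)"
    unfolding s by (intro cong_add cong_mult) auto
  also have "b + (- b * c) * a = b - b * (a * c)" by (simp add: algebra_simps)
  also have "[b - b * (a * c) = b - b * 1] (mod int p)"
    by (intro cong_diff cong_mult c) auto
  finally have s_sol: "int p dvd b + int s * a" by (simp add: cong_0_iff)
  have "int s < int p" unfolding s using ppos by simp
  then have s_less: "s < p" by simp
  have uniq: "t = s" if "t < p" "int p dvd b + int t * a" for t
  proof -
    have "int p dvd (b + int t * a) - (b + int s * a)" using that s_sol by (intro dvd_diff)
    then have "int p dvd (int t - int s) * a" by (simp add: algebra_simps)
    then have "int p dvd int t - int s"
      using p a by (simp add: prime_dvd_mult_iff)
    then have "[int t = int s] (mod int p)" by (simp add: cong_iff_dvd_diff)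
    then have "[t = s] (mod p)" by (simp add: cong_int_iff)
    then show ?thesis using that(1) s_less unfolding cong_def by simp
  qed
  have "{t. t < p \<and> int p dvd b + int t * a} = {s}"
    using uniq s_sol s_less by blast
  then show ?thesis by simp
qed

lemma sum_card_swap:
  assumes "finite A"
  shows "(\<Sum>t<p. card {u \<in> A. P t u}) = (\<Sum>u\<in>A. card {t. t < (p::nat) \<and> P t u})"
proof -
  have "(\<Sum>t<p. card {u \<in> A. P t u}) = (\<Sum>t<p. \<Sum>u\<in>A. of_bool (P t u))"
    using assms by (intro sum.cong) (auto simp: sum_of_bool_eq Int_def)
  also have "\<dots> = (\<Sum>u\<in>A. \<Sum>t<p. of_bool (P t u))" by (rule sum.swap)
  also have "\<dots> = (\<Sum>u\<in>A. card {t. t < p \<and> P t u})"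
    by (intro sum.cong) (auto simp: sum_of_bool_eq Int_def)
  finally show ?thesis .
qed


section \<open>Groups whose commutators are measured by a form modulo a prime\<close>

text \<open>
  The form takes integer values that matter only modulo \<open>p\<close>. This makes scalar multiples
  available as powers in \<open>G\<close>, so that the quotient of \<open>G\<close> by its center need not be turned
  into a vector space over the field with \<open>p\<close> elements.
\<close>

locale commutator_form_group = group G for G (structure) +
  fixes p :: nat and \<beta> :: "'a \<Rightarrow> 'a \<Rightarrow> int"
  assumes finite_carrier: "finite (carrier G)"
    and prime_p: "prime p"
    and form_mult: "\<lbrakk>g \<in> carrier G; h \<in> carrier G; u \<in> carrier G\<rbrakk>
      \<Longrightarrow> [\<beta> (g \<otimes> h) u = \<beta> g u + \<beta> h u] (mod int p)"
    and form_skew: "\<beta> h g = - \<beta> g h"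
    and commute_iff: "\<lbrakk>g \<in> carrier G; h \<in> carrier G\<rbrakk>
      \<Longrightarrow> g \<otimes> h = h \<otimes> g \<longleftrightarrow> int p dvd \<beta> g h"
begin

abbreviation "\<Gamma> \<equiv> commuting_graph G"

abbreviation "C \<equiv> neighborhood \<Gamma>"

abbreviation "N \<equiv> card (carrier G)"

definition center :: "'a set" where
  "center = {z \<in> carrier G. C z = carrier G}"

lemma C_altdef: "g \<in> carrier G \<Longrightarrow> C g = {u \<in> carrier G. int p dvd \<beta> g u}"
  by (auto simp: neighborhood_def commuting_graph_def commute_iff)

lemma C_subset: "C g \<subseteq> carrier G"
  by (auto simp: neighborhood_def commuting_graph_def)

lemma p_pos: "0 < p"
  using prime_p prime_gt_0_nat by blast

lemma N_pos: "0 < N"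
  using finite_carrier by (simp add: card_gt_0_iff carrier_not_empty)

lemma form_mult_right:
  assumes "g \<in> carrier G" "h \<in> carrier G" "u \<in> carrier G"
  shows "[\<beta> u (g \<otimes> h) = \<beta> u g + \<beta> u h] (mod int p)"
proof -
  have "[- \<beta> (g \<otimes> h) u = - (\<beta> g u + \<beta> h u)] (mod int p)"
    using form_mult[OF assms] by (simp only: cong_minus_minus_iff)
  then show ?thesis
    by (simp add: form_skew[of u])
qed

lemma form_pow:
  assumes "g \<in> carrier G" "u \<in> carrier G"
  shows "[\<beta> (g [^] n) u = int n * \<beta> g u] (mod int p)"
proof (induction n)
  case 0
  have "[\<beta> (\<one> \<otimes> \<one>) u = \<beta> \<one> u + \<beta> \<one> u] (mod int p)"
    using assms by (intro form_mult) auto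
  then have "[\<beta> \<one> u + 0 = \<beta> \<one> u + \<beta> \<one> u] (mod int p)" by simp
  then have "[0 = \<beta> \<one> u] (mod int p)"
    unfolding cong_add_lcancel .
  then show ?case by (simp add: cong_sym_eq)
next
  case (Suc n)
  have "[\<beta> (g [^] Suc n) u = \<beta> (g [^] n) u + \<beta> g u] (mod int p)"
    using assms by (auto intro: form_mult)
  also have "[\<beta> (g [^] n) u + \<beta> g u = int n * \<beta> g u + \<beta> g u] (mod int p)"
    by (intro cong_add Suc.IH) auto
  finally show ?case by (simp add: algebra_simps)
qed

lemma form_mult_pow:
  assumes "g \<in> carrier G" "h \<in> carrier G" "u \<in> carrier G"
  shows "int p dvd \<beta> (h \<otimes> g [^] n) u \<longleftrightarrow> int p dvd \<beta> h u + int n * \<beta> g u"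
proof -
  have "[\<beta> (h \<otimes> g [^] n) u = \<beta> h u + \<beta> (g [^] n) u] (mod int p)"
    using assms by (intro form_mult) auto
  also have "[\<beta> h u + \<beta> (g [^] n) u = \<beta> h u + int n * \<beta> g u] (mod int p)"
    using assms by (intro cong_add form_pow) auto
  finally show ?thesis by (rule cong_dvd_iff)
qed

lemma form_mult_pow_right:
  assumes "g \<in> carrier G" "h \<in> carrier G" "u \<in> carrier G"
  shows "int p dvd \<beta> u (h \<otimes> g [^] n) \<longleftrightarrow> int p dvd \<beta> u h + int n * \<beta> u g"
proof -
  have "\<beta> u h + int n * \<beta> u g = - (\<beta> h u + int n * \<beta> g u)"
    by (simp add: form_skew[of u])
  then show ?thesis
    using form_mult_pow[OF assms, of n] by (simp only: form_skew[of u "h \<otimes> g [^] n"] dvd_minus_iff)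
qed

text \<open>
  Choose \<open>e\<close> that does not commute with \<open>g\<close>. Each of the \<open>p\<close> translates of \<open>C g\<close> by a power
  of \<open>e\<close> has the size of \<open>C g\<close>, and each \<open>u\<close> lies in exactly one of them, because
  \<open>\<beta> g (u e\<^sup>t) = \<beta> g u + t \<beta> g e\<close> vanishes for exactly one \<open>t\<close>.
\<close>

lemma card_C:
  assumes g: "g \<in> carrier G" "g \<notin> center"
  shows "p * card (C g) = N"
proof -
  obtain e where e: "e \<in> carrier G" "\<not> int p dvd \<beta> g e"
    using g C_subset[of g] by (auto simp: center_def C_altdef)
  have translate: "card {u \<in> carrier G. int p dvd \<beta> g (u \<otimes> e [^] t)} = card (C g)" for t :: nat
  proof (rule bij_betw_same_card)
    show "bij_betw (\<lambda>u. u \<otimes> e [^] t) {u \<in> carrier G. int p dvd \<beta> g (u \<otimes> e [^] t)} (C g)"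
      by (rule bij_betwI[where g = "\<lambda>u. u \<otimes> inv (e [^] t)"])
        (use e g in \<open>auto simp: C_altdef m_assoc\<close>)
  qed
  have "p * card (C g) = (\<Sum>t<p. card {u \<in> carrier G. int p dvd \<beta> g (u \<otimes> e [^] t)})"
    by (simp add: translate)
  also have "\<dots> = (\<Sum>u\<in>carrier G. card {t. t < p \<and> int p dvd \<beta> g (u \<otimes> e [^] t)})"
    using finite_carrier by (rule sum_card_swap)
  also have "\<dots> = (\<Sum>u\<in>carrier G. 1)"
    by (rule sum.cong)
      (use e g in \<open>auto simp: form_mult_pow_right card_linear_congruence[OF prime_p]\<close>)
  finally show ?thesis by simp
qed

text \<open>
  Linear independence of the functionals \<open>\<beta> g\<close> and \<open>\<beta> h\<close> modulo \<open>p\<close>: central elements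
  are those whose functional is zero, and \<open>h \<otimes> g [^] t\<close> has the functional
  \<open>\<beta> h + t \<beta> g\<close>.
\<close>

definition independent :: "'a \<Rightarrow> 'a \<Rightarrow> bool" where
  "independent g h \<longleftrightarrow> g \<notin> center \<and> (\<forall>t<p. h \<otimes> g [^] t \<notin> center)"

text \<open>
  Double counting over the pencil of centralizers \<open>C (h \<otimes> g [^] t)\<close>, \<open>t < p\<close>, each of size
  \<open>N / p\<close> by independence. A point outside \<open>C g\<close> lies in exactly one of them; a point of
  \<open>C g\<close> lies in all of them if it belongs to \<open>C h\<close> and in none otherwise. Hence
  \<open>p (N / p) = p |C g \<inter> C h| + (N - N / p)\<close>.
\<close>

lemma card_C_Int_C:
  assumes g: "g \<in> carrier G" and h: "h \<in> carrier G" and indep: "independent g h"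
  shows "p\<^sup>2 * card (C g \<inter> C h) = N"
proof -
  have count: "card {t. t < p \<and> u \<in> C (h \<otimes> g [^] t)} =
      (if u \<in> C g then if u \<in> C h then p else 0 else 1)" if u: "u \<in> carrier G" for u
  proof -
    have mem: "u \<in> C (h \<otimes> g [^] t) \<longleftrightarrow> int p dvd \<beta> h u + int t * \<beta> g u" for t :: nat
      using g h u by (simp add: C_altdef form_mult_pow)
    show ?thesis
    proof (cases "u \<in> C g")
      case True
      then have "int p dvd \<beta> h u + int t * \<beta> g u \<longleftrightarrow> u \<in> C h" for t :: nat
        using g h u by (simp add: C_altdef dvd_add_left_iff)
      then show ?thesis using True by (simp add: mem)
    next
      case False
      then show ?thesis
        using g u by (simp add: mem C_altdef card_linear_congruence[OF prime_p])
    qed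
  qed
  have [simp]: "finite (C u)" for u
    using C_subset finite_carrier finite_subset by blast
  have gp: "p * card (C g) = N"
    using indep g by (auto simp: independent_def card_C)
  have "p * N = (\<Sum>t<p. p * card (C (h \<otimes> g [^] t)))"
    using indep g h by (simp add: independent_def card_C)
  also have "\<dots> = p * (\<Sum>t<p. card {u \<in> carrier G. u \<in> C (h \<otimes> g [^] t)})"
    unfolding sum_distrib_left
    by (intro sum.cong arg_cong[where f = "\<lambda>A. p * card A"]) (use C_subset in auto)
  also have "\<dots> = p * (\<Sum>u\<in>carrier G. card {t. t < p \<and> u \<in> C (h \<otimes> g [^] t)})"
    using finite_carrier by (simp add: sum_card_swap)
  also have "(\<Sum>u\<in>carrier G. card {t. t < p \<and> u \<in> C (h \<otimes> g [^] t)})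
      = (\<Sum>u\<in>carrier G. if u \<in> C g then if u \<in> C h then p else 0 else 1)"
    by (intro sum.cong) (auto simp: count)
  also have "\<dots> = (\<Sum>u\<in>carrier G. p * of_bool (u \<in> C g \<inter> C h) + of_bool (u \<in> carrier G - C g))"
    by (intro sum.cong) auto
  also have "\<dots> = p * card (C g \<inter> C h) + card (carrier G - C g)"
  proof -
    have "carrier G \<inter> (C g \<inter> C h) = C g \<inter> C h" "carrier G \<inter> (carrier G - C g) = carrier G - C g"
      using C_subset by auto
    moreover have "(\<Sum>u\<in>carrier G. of_bool (u \<in> A) :: nat) = card (carrier G \<inter> A)" for A
      using finite_carrier by (simp add: sum_of_bool_eq)
    ultimately show ?thesis
      by (simp only: sum.distrib flip: sum_distrib_left)
  qed
  also have "card (carrier G - C g) = N - card (C g)"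
    using C_subset by (simp add: card_Diff_subset)
  finally have "p * N = p\<^sup>2 * card (C g \<inter> C h) + (p * N - p * card (C g))"
    by (simp add: algebra_simps power2_eq_square diff_mult_distrib2)
  moreover have "N \<le> p * N" using p_pos by simp
  ultimately show ?thesis unfolding gp by linarith
qed

lemma center_subset: "center \<subseteq> carrier G"
  by (auto simp: center_def)

lemma finite_center: "finite center"
  using center_subset finite_carrier finite_subset by blast

text \<open>
  A dependent pair has \<open>g\<close> central, or \<open>h = z g\<^sup>-\<^sup>t\<close> for a central \<open>z\<close> and some \<open>t < p\<close>,
  so that \<open>g\<close>, \<open>t\<close> and \<open>z\<close> determine it.
\<close>

lemma card_dependent:
  "card {(g, h). g \<in> carrier G \<and> h \<in> carrier G \<and> \<not> independent g h} \<le> (p + 1) * card center * N"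
proof -
  let ?f = "\<lambda>(g, t, z). (g, z \<otimes> inv (g [^] (t::nat)))"
  have "(g, h) \<in> center \<times> carrier G \<union> ?f ` (carrier G \<times> {..<p} \<times> center)"
    (is "_ \<in> ?A \<union> ?B")
    if gh: "g \<in> carrier G" "h \<in> carrier G" "\<not> independent g h" for g h
  proof (cases "g \<in> center")
    case True
    then show ?thesis using gh by simp
  next
    case False
    then obtain t where t: "t < p" "h \<otimes> g [^] t \<in> center"
      using gh by (auto simp: independent_def)
    then have "(g, h) = ?f (g, t, h \<otimes> g [^] t)"
      using gh by (simp add: m_assoc)
    moreover have "(g, t, h \<otimes> g [^] t) \<in> carrier G \<times> {..<p} \<times> center"
      using gh t by simp
    ultimately show ?thesis by blast
  qed
  then have "{(g, h). g \<in> carrier G \<and> h \<in> carrier G \<and> \<not> independent g h} \<subseteq> ?A \<union> ?B"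
    by blast
  then have "card {(g, h). g \<in> carrier G \<and> h \<in> carrier G \<and> \<not> independent g h} \<le> card (?A \<union> ?B)"
    using finite_carrier finite_center by (intro card_mono) auto
  also have "\<dots> \<le> card ?A + card ?B" by (rule card_Un_le)
  also have "card ?B \<le> N * (p * card center)"
    using card_image_le[of "carrier G \<times> {..<p} \<times> center" ?f] finite_carrier finite_center
    by (simp add: card_cartesian_product)
  finally show ?thesis by (simp add: card_cartesian_product algebra_simps)
qed

lemma density_eq: "density \<Gamma> = 1 / p + (1 - 1 / p) * (card center / N)"
proof -
  have "parcs \<Gamma> = Sigma (carrier G) C"
    by (auto simp: commuting_graph_def neighborhood_def)
  then have "real (card (parcs \<Gamma>)) = (\<Sum>g\<in>carrier G. real (card (C g)))"
    using finite_carrier finite_subset[OF C_subset] by (simp add: card_SigmaI)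
  also have "\<dots> = (\<Sum>g\<in>carrier G. N / p + (1 - 1 / p) * N * of_bool (g \<in> center))"
  proof (intro sum.cong refl)
    fix g assume g: "g \<in> carrier G"
    show "real (card (C g)) = N / p + (1 - 1 / p) * N * of_bool (g \<in> center)"
    proof (cases "g \<in> center")
      case True
      then show ?thesis by (simp add: center_def algebra_simps)
    next
      case False
      then show ?thesis using card_C[OF g] p_pos by (simp add: field_simps flip: of_nat_mult)
    qed
  qed
  also have "\<dots> = N * (N / p) + (1 - 1 / p) * N * card center"
    using finite_carrier center_subset
    by (simp add: sum.distrib sum_of_bool_eq Int_absorb1 Int_absorb2 Int_def flip: sum_distrib_left)
      (metis (no_types, lifting) Collect_cong Collect_mem_eq subsetD)
  finally have "real (card (parcs \<Gamma>)) = N * (N / p) + (1 - 1 / p) * N * card center" .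
  then show ?thesis
    using N_pos by (simp add: density_def commuting_graph_def field_simps power2_eq_square)
qed

lemma density_square_close: "\<bar>(density \<Gamma>)\<^sup>2 - (1 / p)\<^sup>2\<bar> \<le> 2 * card center / N"
proof -
  define r where "r = real (card center) / N"
  have r: "0 \<le> r" "r \<le> 1"
    using N_pos card_mono[OF finite_carrier center_subset] by (auto simp: r_def)
  have a: "0 \<le> 1 / real p" "1 / real p \<le> 1" using p_pos by auto
  have d: "density \<Gamma> = 1 / p + (1 - 1 / p) * r" by (simp add: density_eq r_def)
  have "(1 - 1 / p) * r \<le> (1 - 1 / p) * 1" using a r by (intro mult_left_mono) auto
  then have le1: "density \<Gamma> \<le> 1" by (simp add: d)
  have "(1 - 1 / p) * r \<le> 1 * r" using a r by (intro mult_right_mono) auto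
  then have diff: "density \<Gamma> - 1 / p \<le> r" "0 \<le> density \<Gamma> - 1 / p"
    using a r by (auto simp: d)
  have "(density \<Gamma>)\<^sup>2 - (1 / p)\<^sup>2 = (density \<Gamma> - 1 / p) * (density \<Gamma> + 1 / p)"
    by (simp add: power2_eq_square algebra_simps)
  moreover have "(density \<Gamma> - 1 / p) * (density \<Gamma> + 1 / p) \<le> r * 2"
    using diff le1 a r by (intro mult_mono) linarith+
  moreover have "0 \<le> (density \<Gamma> - 1 / p) * (density \<Gamma> + 1 / p)"
    using diff a by (intro mult_nonneg_nonneg) linarith+
  ultimately have "\<bar>(density \<Gamma>)\<^sup>2 - (1 / p)\<^sup>2\<bar> \<le> 2 * r" by simp
  then show ?thesis by (simp add: r_def)
qed

text \<open>
  The comparison goes through \<open>N / p\<^sup>2\<close>, the exact number of common neighbors of an independent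
  pair: moving from \<open>density\<^sup>2\<close> to \<open>1 / p\<^sup>2\<close> costs \<open>2 |Z|\<close> for every pair, and the
  trivial bound \<open>N\<close> is used for the few dependent pairs.
\<close>

lemma codegree_deviation:
  "(\<Sum>g\<in>carrier G. \<Sum>h\<in>carrier G. \<bar>real (card (C g \<inter> C h)) - (density \<Gamma>)\<^sup>2 * N\<bar>)
    \<le> (p + 3) * card center * (real N)\<^sup>2"
proof -
  have pointwise: "\<bar>real (card (C g \<inter> C h)) - (density \<Gamma>)\<^sup>2 * N\<bar>
      \<le> 2 * real (card center) + real N * of_bool (\<not> independent g h)"
    if g: "g \<in> carrier G" and h: "h \<in> carrier G" for g h
  proof -
    have "\<bar>(1 / p)\<^sup>2 * N - (density \<Gamma>)\<^sup>2 * N\<bar> = \<bar>(density \<Gamma>)\<^sup>2 - (1 / p)\<^sup>2\<bar> * N"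
      by (metis abs_minus_commute abs_mult abs_of_nat left_diff_distrib)
    also have "\<dots> \<le> 2 * card center / N * N"
      by (intro mult_right_mono density_square_close) auto
    finally have dens: "\<bar>(1 / p)\<^sup>2 * N - (density \<Gamma>)\<^sup>2 * N\<bar> \<le> 2 * real (card center)"
      using N_pos by simp
    have codeg: "\<bar>real (card (C g \<inter> C h)) - (1 / p)\<^sup>2 * N\<bar> \<le> real N * of_bool (\<not> independent g h)"
    proof (cases "independent g h")
      case True
      have "real N = (real p)\<^sup>2 * card (C g \<inter> C h)"
        using card_C_Int_C[OF g h True] by (metis of_nat_mult of_nat_power)
      then show ?thesis using True p_pos by (simp add: field_simps)
    next
      case False
      have "real (card (C g \<inter> C h)) \<le> real N"
        unfolding of_nat_le_iff using C_subset finite_carrier by (intro card_mono) auto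
      moreover have "(1 / real p)\<^sup>2 * real N \<le> 1 * real N"
        using p_pos by (intro mult_right_mono) (auto simp: power_le_one)
      moreover have "0 \<le> (1 / real p)\<^sup>2 * real N" by simp
      ultimately have "\<bar>real (card (C g \<inter> C h)) - (1 / real p)\<^sup>2 * real N\<bar> \<le> real N"
        by linarith
      then show ?thesis using False by simp
    qed
    show ?thesis using dens codeg by linarith
  qed
  have dep: "(\<Sum>g\<in>carrier G. \<Sum>h\<in>carrier G. of_bool (\<not> independent g h) :: real)
      = card {(g, h). g \<in> carrier G \<and> h \<in> carrier G \<and> \<not> independent g h}"
  proof -
    have "{(g, h). g \<in> carrier G \<and> h \<in> carrier G \<and> \<not> independent g h}
        = Sigma (carrier G) (\<lambda>g. carrier G \<inter> {h. \<not> independent g h})"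
      by auto
    then show ?thesis
      using finite_carrier by (simp add: sum_of_bool_eq card_SigmaI)
  qed
  have "(\<Sum>g\<in>carrier G. \<Sum>h\<in>carrier G. \<bar>real (card (C g \<inter> C h)) - (density \<Gamma>)\<^sup>2 * N\<bar>)
      \<le> (\<Sum>g\<in>carrier G. \<Sum>h\<in>carrier G.
        2 * real (card center) + real N * of_bool (\<not> independent g h))"
    by (intro sum_mono pointwise)
  also have "\<dots> = 2 * card center * (real N)\<^sup>2
      + N * real (card {(g, h). g \<in> carrier G \<and> h \<in> carrier G \<and> \<not> independent g h})"
    by (simp add: sum.distrib dep[symmetric] sum_distrib_left power2_eq_square algebra_simps)
  also have "\<dots> \<le> 2 * card center * (real N)\<^sup>2 + N * real ((p + 1) * card center * N)"
    using card_dependent by (intro add_left_mono mult_left_mono) (auto simp only: of_nat_le_iff of_nat_0_le_iff)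
  also have "\<dots> = (p + 3) * card center * (real N)\<^sup>2"
    by (simp add: power2_eq_square algebra_simps)
  finally show ?thesis by simp
qed

end

lemma pair_pseudo_graph_commuting_graph:
  assumes "finite (carrier G)"
  shows "pair_pseudo_graph (commuting_graph G)"
proof
  show "finite (parcs (commuting_graph G))"
    by (rule finite_subset[of _ "carrier G \<times> carrier G"])
      (use assms in \<open>auto simp: commuting_graph_def\<close>)
qed (use assms in \<open>auto simp: commuting_graph_def symmetric_def intro!: symI\<close>)


section \<open>The symplectic form of the Heisenberg group\<close>

definition symplectic :: "nat \<Rightarrow> heis \<Rightarrow> heis \<Rightarrow> int" where
  "symplectic k = (\<lambda>(x, y, z) (x', y', z'). \<Sum>i\<in>{1..k}. x i * y' i - x' i * y i)"

lemma dot_eq_mod: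
  assumes "prime p" "x \<in> vecs p k" "y \<in> vecs p k"
  shows "dot p k x y = (\<Sum>i\<in>{1..k}. x i * y i) mod int p"
proof -
  interpret F: residues_prime p "prime_ring p"
    by unfold_locales (use assms in auto)
  have "(\<Oplus>\<^bsub>prime_ring p\<^esub>i\<in>A. x i \<otimes>\<^bsub>prime_ring p\<^esub> y i) = (\<Sum>i\<in>A. x i * y i) mod int p"
    if "finite A" "A \<subseteq> {1..k}" for A
    using that
  proof (induction rule: finite_induct)
    case empty
    then show ?case by (simp add: F.zero_cong)
  next
    case (insert a A)
    have mem: "x i \<in> carrier (prime_ring p)" "y i \<in> carrier (prime_ring p)" if "i \<in> {1..k}" for i
      using assms that by (auto simp: vecs_def)
    have "(\<Oplus>\<^bsub>prime_ring p\<^esub>i\<in>insert a A. x i \<otimes>\<^bsub>prime_ring p\<^esub> y i)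
        = x a \<otimes>\<^bsub>prime_ring p\<^esub> y a \<oplus>\<^bsub>prime_ring p\<^esub> (\<Oplus>\<^bsub>prime_ring p\<^esub>i\<in>A. x i \<otimes>\<^bsub>prime_ring p\<^esub> y i)"
      by (rule F.finsum_insert) (use insert mem in auto)
    then show ?case using insert by (simp add: F.res_add_eq F.res_mult_eq mod_simps)
  qed
  then show ?thesis by (simp add: dot_def)
qed

lemma commutator_form_group_heisenberg:
  assumes p: "prime p"
  shows "commutator_form_group (heisenberg p k) p (symplectic k)"
proof -
  interpret F: residues_prime p "prime_ring p"
    by unfold_locales (use p in auto)
  interpret group "heisenberg p k" by (rule group_heisenberg[OF p])
  show ?thesis
  proof
    show "finite (carrier (heisenberg p k))"
      using p by (intro card_ge_0_finite) (simp add: card_heisenberg prime_gt_0_nat)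
  next
    fix g h u :: heis
    obtain x y z x' y' z' a b c where [simp]: "g = (x, y, z)" "h = (x', y', z')" "u = (a, b, c)"
      by (metis prod_cases3)
    have "[(x i + x' i) mod int p * b i - a i * ((y i + y' i) mod int p)
        = (x i * b i - a i * y i) + (x' i * b i - a i * y' i)] (mod int p)" for i
    proof -
      have "[(x i + x' i) mod int p * b i - a i * ((y i + y' i) mod int p)
          = (x i + x' i) * b i - a i * (y i + y' i)] (mod int p)"
        by (intro cong_diff cong_mult) auto
      then show ?thesis by (simp add: algebra_simps)
    qed
    then show "[symplectic k (g \<otimes>\<^bsub>heisenberg p k\<^esub> h) u = symplectic k g u + symplectic k h u] (mod int p)"
      by (auto simp: symplectic_def heisenberg_def vec_add_def F.res_add_eq sum.distrib[symmetric]
          intro!: cong_sum)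
  next
    fix g h :: heis
    show "symplectic k h g = - symplectic k g h"
      by (auto simp: symplectic_def sum_negf[symmetric] split: prod.split intro!: sum.cong)
  next
    fix g h assume gh: "g \<in> carrier (heisenberg p k)" "h \<in> carrier (heisenberg p k)"
    obtain x y z x' y' z' where [simp]: "g = (x, y, z)" "h = (x', y', z')"
      by (metis prod_cases3)
    from gh have m: "x \<in> vecs p k" "y \<in> vecs p k" "x' \<in> vecs p k" "y' \<in> vecs p k"
      by (auto simp: heisenberg_def)
    let ?s = "\<Sum>i\<in>{1..k}. x i * y' i" and ?s' = "\<Sum>i\<in>{1..k}. x' i * y i"
    have "vec_add p k u v = vec_add p k v u" for u v
      by (simp add: vec_add_def F.res_add_eq add.commute)
    then have "g \<otimes>\<^bsub>heisenberg p k\<^esub> h = h \<otimes>\<^bsub>heisenberg p k\<^esub> g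
        \<longleftrightarrow> [(z + z') + ?s = (z + z') + ?s'] (mod int p)"
      using m by (simp add: heisenberg_def F.res_add_eq dot_eq_mod[OF p] mod_simps cong_def add.commute)
    also have "\<dots> \<longleftrightarrow> [?s = ?s'] (mod int p)" by (rule cong_add_lcancel)
    also have "\<dots> \<longleftrightarrow> int p dvd symplectic k g h"
      by (simp add: cong_iff_dvd_diff symplectic_def sum_subtractf)
    finally show "g \<otimes>\<^bsub>heisenberg p k\<^esub> h = h \<otimes>\<^bsub>heisenberg p k\<^esub> g
        \<longleftrightarrow> int p dvd symplectic k g h" .
  qed (rule p)
qed

text \<open>
  Nondegeneracy of the symplectic form: pairing a central element with the elements whose
  \<open>y\<close>- or \<open>x\<close>-part is a unit vector shows that its own vector parts vanish, which leaves only
  the \<open>z\<close>-coordinate free.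
\<close>

lemma card_center_heisenberg:
  assumes p: "prime p"
  shows "card (commutator_form_group.center (heisenberg p k)) \<le> p"
proof -
  interpret F: residues_prime p "prime_ring p"
    by unfold_locales (use p in auto)
  interpret commutator_form_group "heisenberg p k" p "symplectic k"
    by (rule commutator_form_group_heisenberg[OF p])
  define o0 where "o0 = (\<lambda>i\<in>{1..k}. 0 :: int)"
  define e where "e = (\<lambda>i. \<lambda>j\<in>{1..k}. of_bool (i = j) :: int)"
  have carr: "carrier (prime_ring p) = {0..<int p}"
    by (auto simp: residue_ring_def)
  have vecs: "o0 \<in> vecs p k" "e i \<in> vecs p k" for i
    using prime_gt_1_nat[OF p] by (auto simp: vecs_def carr o0_def e_def)
  have vanish: "v = o0" if v: "v \<in> vecs p k" and dvd: "\<And>i. i \<in> {1..k} \<Longrightarrow> int p dvd v i" for v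
  proof
    fix i show "v i = o0 i"
    proof (cases "i \<in> {1..k}")
      case True
      then have "v i \<in> {0..<int p}" using v by (auto simp: vecs_def carr)
      then show ?thesis using dvd[OF True] True by (auto simp: o0_def dest: zdvd_imp_le)
    next
      case False
      then show ?thesis using v by (auto simp: vecs_def o0_def PiE_def extensional_def)
    qed
  qed
  have "center \<subseteq> {o0} \<times> {o0} \<times> {0..<int p}"
  proof
    fix g assume g: "g \<in> center"
    obtain x y z where [simp]: "g = (x, y, z)" by (metis prod_cases3)
    from g have gc: "g \<in> carrier (heisenberg p k)" by (simp add: center_def)
    then have m: "x \<in> vecs p k" "y \<in> vecs p k" "z \<in> {0..<int p}"
      by (auto simp: heisenberg_def carr)
    have orth: "int p dvd symplectic k g h" if "h \<in> carrier (heisenberg p k)" for h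
      using g that C_altdef[OF gc] by (auto simp: center_def)
    have zero: "0 \<in> carrier (prime_ring p)" using p_pos by (simp add: carr)
    have "int p dvd x i" if i: "i \<in> {1..k}" for i
    proof -
      have "symplectic k g (o0, e i, 0) = (\<Sum>j\<in>{1..k}. if i = j then x j else 0)"
        unfolding symplectic_def \<open>g = (x, y, z)\<close> prod.case
        by (intro sum.cong) (auto simp: o0_def e_def)
      then show ?thesis
        using orth[of "(o0, e i, 0)"] vecs zero i by (simp add: heisenberg_def)
    qed
    moreover have "int p dvd y i" if i: "i \<in> {1..k}" for i
    proof -
      have "symplectic k g (e i, o0, 0) = (\<Sum>j\<in>{1..k}. if i = j then - y j else 0)"
        unfolding symplectic_def \<open>g = (x, y, z)\<close> prod.case
        by (intro sum.cong) (auto simp: o0_def e_def)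
      then show ?thesis
        using orth[of "(e i, o0, 0)"] vecs zero i by (simp add: heisenberg_def)
    qed
    ultimately have "x = o0" "y = o0"
      using vanish m by blast+
    then show "g \<in> {o0} \<times> {o0} \<times> {0..<int p}"
      using m by simp
  qed
  then have "card center \<le> card ({o0} \<times> {o0} \<times> {0..<int p})"
    by (intro card_mono) auto
  then show ?thesis by (simp add: card_cartesian_product)
qed


section \<open>Quasirandomness\<close>

theorem mainTheorem2:
  fixes p :: nat
  assumes "prime p"
  shows "quasirandom (\<lambda>k. commuting_graph (heisenberg p (Suc k)))"
proof -
  let ?H = "\<lambda>k. heisenberg p (Suc k)"
  let ?N = "\<lambda>k. card (carrier (?H k))"
  have pverts: "pverts (commuting_graph G) = carrier G" for G :: "heis monoid"
    by (simp add: commuting_graph_def)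
  have p2: "2 \<le> p" using assms prime_ge_2_nat by blast
  have N_ge: "k \<le> ?N k" for k
  proof -
    have "k \<le> 2 * Suc k + 1" by simp
    also have "\<dots> \<le> p ^ (2 * Suc k + 1)" using self_le_ge2_pow[OF p2] .
    finally show ?thesis by (simp add: card_heisenberg)
  qed
  have lim: "filterlim ?N at_top sequentially"
    by (rule filterlim_at_top_mono[OF filterlim_ident]) (use N_ge in auto)
  define S where "S k = (\<Sum>v\<in>carrier (?H k). \<Sum>w\<in>carrier (?H k).
        \<bar>real (card (neighborhood (commuting_graph (?H k)) v \<inter> neighborhood (commuting_graph (?H k)) w))
          - (density (commuting_graph (?H k)))\<^sup>2 * real (?N k)\<bar>)" for k
  have bound: "S k \<le> real ((p + 3) * p) * real (?N k) ^ 2" for k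
  proof -
    interpret commutator_form_group "?H k" p "symplectic (Suc k)"
      by (rule commutator_form_group_heisenberg[OF assms])
    have "S k \<le> real (p + 3) * real (card center) * (real (?N k))\<^sup>2"
      using codegree_deviation by (simp add: S_def)
    also have "\<dots> \<le> real (p + 3) * real p * (real (?N k))\<^sup>2"
      using card_center_heisenberg[OF assms] by (intro mult_right_mono mult_left_mono) auto
    finally show ?thesis by simp
  qed
  have "S \<in> O(\<lambda>k. real (?N k) ^ 2)"
  proof (rule bigoI)
    have "norm (S k) = S k" for k by (simp add: S_def sum_nonneg)
    then show "\<forall>\<^sub>F k in sequentially. norm (S k) \<le> real ((p + 3) * p) * norm (real (?N k) ^ 2)"
      using bound by simp
  qed
  also have "(\<lambda>k. real (?N k) ^ 2) \<in> o(\<lambda>k. real (?N k) ^ 3)"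
  proof (rule landau_o.small.compose[where f = "\<lambda>n. real n ^ 2" and g = "\<lambda>n. real n ^ 3", OF _ lim])
    show "(\<lambda>n. real n ^ 2) \<in> o(\<lambda>n. real n ^ 3)"
    proof (rule smalloI_tendsto)
      have "\<forall>\<^sub>F n in sequentially. 1 / real n = real n ^ 2 / real n ^ 3"
        using eventually_gt_at_top[of 0] by eventually_elim (simp add: field_simps power2_eq_square power3_eq_cube)
      then show "(\<lambda>n. real n ^ 2 / real n ^ 3) \<longlonglongrightarrow> 0"
        by (rule Lim_transform_eventually[OF lim_1_over_n])
    qed (use eventually_gt_at_top[of "0 :: nat"] in eventually_elim, simp)
  qed
  finally have small: "S \<in> o(\<lambda>k. real (?N k) ^ 3)" .
  have graph: "pair_pseudo_graph (commuting_graph (?H k))" for k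
    by (intro pair_pseudo_graph_commuting_graph
        commutator_form_group.finite_carrier[OF commutator_form_group_heisenberg[OF assms]])
  show ?thesis
    unfolding quasirandom_def pverts using graph lim small by (simp add: S_def[abs_def])
qed

end
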